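(* For all integers $n\ge 0$, \[ o_E(\Gamma_n,1) = \frac{1-(-1)^n}{2}F_{\lfloor \frac{n+1}{2}\rfloor}, \] \[ o_E(\Gamma_n,2) = \frac{1}{10}\big(nF_{n+1} + 2(n+1)F_n\big) - \frac{1-(-1)^n}{4}F_{\lfloor \frac{n+1}{2}\rfloor}, \] \[ o_E(\Gamma_n) = \frac{1}{10}\big(nF_{n+1} + 2(n+1)F_n\big) + \frac{1-(-1)^n}{4}F_{\lfloor \frac{n+1}{2}\rfloor}. \]
   Context: The Fibonacci cube $\Gamma_n$ is the subgraph of the $n$-cube $Q_n$ (binary strings of length $n$, adjacent iff they differ in exactly one position) induced by the binary strings of length $n$ with no two consecutive 1s ($\Gamma_0$ has the single vertex given by the empty string). For a graph $G$, $o_E(G)$ is the number of orbits of ${\rm Aut}(G)$ acting on $E(G)$ via $\{u,v\}\mapsto\{g(u),g(v)\}$ and $o_E(G,k)$ is the number of such orbits of size $k$. $F_m$ are Fibonacci numbers with $F_0=0$, $F_1=1$. *)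

theory Defs
  imports "HOL-Algebra.Group_Action" "HOL-Number_Theory.Fib"
begin

record 'a ugraph =
  verts :: "'a set"
  edges :: "'a set set"

definition simple_graph :: "'a ugraph \<Rightarrow> bool" where
  "simple_graph G \<longleftrightarrow>
     (\<forall>e\<in>edges G. \<exists>u\<in>verts G. \<exists>v\<in>verts G. u \<noteq> v \<and> e = {u, v})"

definition induced_subgraph :: "'a ugraph \<Rightarrow> 'a set \<Rightarrow> 'a ugraph" where
  "induced_subgraph G W =
     \<lparr>verts = verts G \<inter> W, edges = {e \<in> edges G. e \<subseteq> W}\<rparr>"

text \<open>Binary strings are boolean lists, with \<open>True\<close> for the digit 1.\<close>

definition hypercube :: "nat \<Rightarrow> bool list ugraph" where
  "hypercube n =
     \<lparr>verts = {x. length x = n},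
      edges = {{x, y} | x y. length x = n \<and> length y = n \<and>
                 card {i. i < n \<and> x ! i \<noteq> y ! i} = 1}\<rparr>"

definition no_consecutive_ones :: "bool list \<Rightarrow> bool" where
  "no_consecutive_ones x \<longleftrightarrow>
     (\<forall>i. Suc i < length x \<longrightarrow> \<not> (x ! i \<and> x ! Suc i))"

definition fibonacci_cube :: "nat \<Rightarrow> bool list ugraph" where
  "fibonacci_cube n = induced_subgraph (hypercube n) {x. no_consecutive_ones x}"

text \<open>As for \<^const>\<open>BijGroup\<close>, automorphisms are extensional functions on the vertex set, so
  that each permutation of the vertices is represented exactly once.\<close>

definition graph_auto :: "'a ugraph \<Rightarrow> ('a \<Rightarrow> 'a) set" where
  "graph_auto G = {g \<in> Bij (verts G).
     \<forall>u\<in>verts G. \<forall>v\<in>verts G. {g u, g v} \<in> edges G \<longleftrightarrow> {u, v} \<in> edges G}"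

definition Aut :: "'a ugraph \<Rightarrow> ('a \<Rightarrow> 'a) monoid" where
  "Aut G = BijGroup (verts G) \<lparr>carrier := graph_auto G\<rparr>"

definition edge_action :: "'a ugraph \<Rightarrow> ('a \<Rightarrow> 'a) \<Rightarrow> 'a set \<Rightarrow> 'a set" where
  "edge_action G g = (\<lambda>e\<in>edges G. g ` e)"

definition edge_orbits :: "'a ugraph \<Rightarrow> 'a set set set" where
  "edge_orbits G = orbits (Aut G) (edges G) (edge_action G)"

definition num_edge_orbits :: "'a ugraph \<Rightarrow> nat" where
  "num_edge_orbits G = card (edge_orbits G)"

definition num_edge_orbits_of_size :: "'a ugraph \<Rightarrow> nat \<Rightarrow> nat" where
  "num_edge_orbits_of_size G k = card {X \<in> edge_orbits G. card X = k}"

lemma simple_graph_fibonacci_cube: "simple_graph (fibonacci_cube n)"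
proof -
  have "\<exists>u\<in>verts (fibonacci_cube n). \<exists>v\<in>verts (fibonacci_cube n). u \<noteq> v \<and> e = {u, v}"
    if e: "e \<in> edges (fibonacci_cube n)" for e
  proof -
    from e obtain x y where xy: "e = {x, y}" "length x = n" "length y = n"
        "card {i. i < n \<and> x ! i \<noteq> y ! i} = 1"
        "no_consecutive_ones x" "no_consecutive_ones y"
      by (auto simp: fibonacci_cube_def induced_subgraph_def hypercube_def)
    then have "x \<noteq> y" by (metis (mono_tags, lifting) Collect_empty_eq card.empty zero_neq_one)
    with xy have "x \<in> verts (fibonacci_cube n)" "y \<in> verts (fibonacci_cube n)"
      by (auto simp: fibonacci_cube_def induced_subgraph_def hypercube_def)
    with xy(1) \<open>x \<noteq> y\<close> show ?thesis by blast
  qed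
  then show ?thesis by (simp add: simple_graph_def)
qed

lemma subgroup_graph_auto: "subgroup (graph_auto G) (BijGroup (verts G))"
proof (rule subgroup.intro)
  show "graph_auto G \<subseteq> carrier (BijGroup (verts G))"
    by (auto simp: graph_auto_def BijGroup_def)
next
  fix g h assume gh: "g \<in> graph_auto G" "h \<in> graph_auto G"
  then have "\<forall>u\<in>verts G. h u \<in> verts G"
    using Bij_imp_funcset by (fastforce simp: graph_auto_def)
  with gh show "g \<otimes>\<^bsub>BijGroup (verts G)\<^esub> h \<in> graph_auto G"
    by (auto simp: graph_auto_def BijGroup_def compose_Bij compose_eq)
next
  show "\<one>\<^bsub>BijGroup (verts G)\<^esub> \<in> graph_auto G"
    by (simp add: graph_auto_def BijGroup_def id_Bij)
next
  fix g assume g: "g \<in> graph_auto G"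
  then have B: "g \<in> Bij (verts G)" by (simp add: graph_auto_def)
  then have im: "g ` verts G = verts G" by (simp add: Bij_def bij_betw_def)
  have inv: "inv_into (verts G) g u \<in> verts G" "g (inv_into (verts G) g u) = u"
    if "u \<in> verts G" for u
    using that im by (metis inv_into_into, metis f_inv_into_f)
  have "{inv_into (verts G) g u, inv_into (verts G) g v} \<in> edges G \<longleftrightarrow> {u, v} \<in> edges G"
    if "u \<in> verts G" "v \<in> verts G" for u v
  proof -
    have "{g a, g b} \<in> edges G \<longleftrightarrow> {a, b} \<in> edges G" if "a \<in> verts G" "b \<in> verts G" for a b
      using g that by (simp add: graph_auto_def)
    from this[OF inv(1)[OF that(1)] inv(1)[OF that(2)]] show ?thesis
      by (simp add: inv(2) that)
  qed
  then show "inv\<^bsub>BijGroup (verts G)\<^esub> g \<in> graph_auto G"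
    using restrict_inv_into_Bij[OF B] by (simp add: inv_BijGroup[OF B] graph_auto_def)
qed

lemma group_Aut: "group (Aut G)"
  unfolding Aut_def
  by (rule subgroup.subgroup_is_group[OF subgroup_graph_auto group_BijGroup])

lemma group_action_edge_action:
  assumes "simple_graph G"
  shows "group_action (Aut G) (edges G) (edge_action G)"
proof -
  have sub: "e \<subseteq> verts G" if "e \<in> edges G" for e
    using assms that by (fastforce simp: simple_graph_def)
  have closed: "g ` e \<in> edges G" if g: "g \<in> graph_auto G" and e: "e \<in> edges G" for g e
  proof -
    obtain u v where "u \<in> verts G" "v \<in> verts G" "e = {u, v}"
      using assms e by (auto simp: simple_graph_def)
    then show ?thesis using g e by (simp add: graph_auto_def)
  qed
  have bij: "edge_action G g \<in> Bij (edges G)" if g: "g \<in> graph_auto G" for g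
  proof -
    have B: "g \<in> Bij (verts G)" using g by (simp add: graph_auto_def)
    then have inj: "inj_on g (verts G)" and im: "g ` verts G = verts G"
      by (auto simp: Bij_def bij_betw_def)
    have inj': "inj_on ((`) g) (edges G)"
      using sub inj by (meson inj_onI inj_on_image_eq_iff)
    have surj: "\<exists>e'\<in>edges G. e = g ` e'" if e: "e \<in> edges G" for e
    proof -
      obtain u v where uv: "u \<in> verts G" "v \<in> verts G" "e = {u, v}"
        using assms e by (auto simp: simple_graph_def)
      then obtain u' v' where w: "u' \<in> verts G" "v' \<in> verts G" "u = g u'" "v = g v'"
        using im by (metis imageE)
      have "{g u', g v'} \<in> edges G \<longleftrightarrow> {u', v'} \<in> edges G"
        using g w(1,2) by (simp add: graph_auto_def)
      moreover have "e = g ` {u', v'}" using uv(3) w(3,4) by simp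
      ultimately show ?thesis using e by (metis image_empty image_insert)
    qed
    have "(`) g ` edges G = edges G"
    proof (intro equalityI subsetI)
      show "e \<in> edges G" if "e \<in> (`) g ` edges G" for e
        using that closed[OF g] by (elim imageE) simp
      show "e \<in> (`) g ` edges G" if "e \<in> edges G" for e
        using surj[OF that] by (elim bexE) (rule image_eqI)
    qed
    with inj' have "bij_betw ((`) g) (edges G) (edges G)"
      by (simp add: bij_betw_def)
    then show ?thesis
      unfolding edge_action_def Bij_def by (simp cong: bij_betw_cong)
  qed
  have "edge_action G \<in> hom (Aut G) (BijGroup (edges G))"
  proof (rule homI)
    fix g assume "g \<in> carrier (Aut G)"
    then show "edge_action G g \<in> carrier (BijGroup (edges G))"
      using bij by (simp add: Aut_def BijGroup_def)
  next
    fix g h assume "g \<in> carrier (Aut G)" "h \<in> carrier (Aut G)"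
    then have gh: "g \<in> graph_auto G" "h \<in> graph_auto G" by (auto simp: Aut_def)
    then have B: "g \<in> Bij (verts G)" "h \<in> Bij (verts G)" by (auto simp: graph_auto_def)
    have "compose (verts G) g h ` e = g ` (h ` e)" if "e \<in> edges G" for e
      using sub[OF that] by (force simp: compose_def)
    then have "edge_action G (compose (verts G) g h) =
        compose (edges G) (edge_action G g) (edge_action G h)"
      using closed[OF gh(2)] by (simp add: edge_action_def compose_def fun_eq_iff)
    then show "edge_action G (g \<otimes>\<^bsub>Aut G\<^esub> h) =
        edge_action G g \<otimes>\<^bsub>BijGroup (edges G)\<^esub> edge_action G h"
      using B bij gh by (simp add: Aut_def BijGroup_def)
  qed
  then show ?thesis
    by (simp add: group_action_def group_hom_def group_hom_axioms_def group_Aut group_BijGroup)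
qed

end

theory Submission
  imports Defs
begin

text \<open>For \<open>n \<ge> 2\<close> the zero string is the only vertex of degree \<open>n\<close>, so every automorphism
  fixes it and permutes the strings \<open>e\<^sub>i\<close> with a single 1. Two of these have a common neighbour
  other than the zero string iff their positions are not adjacent, so the permutation of positions
  is an automorphism of a path, that is, the identity or the reversal. A string with at least two
  1s is determined by two of its lower neighbours, so the whole automorphism is the identity or
  the reversal of strings. Hence the orbit of an edge \<open>e\<close> is \<open>{e, rev ` e}\<close>, and it remains to
  count the edges, by summing the number of 1s over all vertices, and the edges fixed by reversal,
  which join a palindrome with a 1 in the middle to the palindrome with that 1 deleted.\<close>

section \<open>Vertices and edges of the Fibonacci cube\<close>

definition fib_strings :: "nat \<Rightarrow> bool list set" where
  "fib_strings n = {x. length x = n \<and> no_consecutive_ones x}"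

text \<open>Beyond the end of \<open>x\<close>, \<open>list_update\<close> changes nothing, so
  \<open>flip\<close> is then the identity.\<close>

definition flip :: "bool list \<Rightarrow> nat \<Rightarrow> bool list" where
  "flip x i = x[i := \<not> x ! i]"

abbreviation zeros :: "nat \<Rightarrow> bool list" where
  "zeros n \<equiv> replicate n False"

lemma length_flip [simp]: "length (flip x i) = length x"
  by (simp add: flip_def)

lemma nth_flip: "i < length x \<Longrightarrow> flip x i ! k = (if k = i then \<not> x ! i else x ! k)"
  by (simp add: flip_def nth_list_update)

lemma flip_flip [simp]: "flip (flip x i) i = x"
  by (cases "i < length x") (auto simp: flip_def list_update_beyond)

lemma flip_commute: "flip (flip x i) j = flip (flip x j) i"
  by (cases "i = j") (auto simp: flip_def list_update_swap)

lemma inj_on_flip: "inj_on (flip x) {..<length x}"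
  by (rule inj_onI) (metis lessThan_iff nth_flip)

lemma rev_flip: "i < length x \<Longrightarrow> rev (flip x i) = flip (rev x) (length x - Suc i)"
  by (simp add: flip_def rev_update rev_nth)

text \<open>Opens the library rules on \<open>successively\<close> for \<open>rev\<close> and
  \<open>@\<close>.\<close>

lemma no_consecutive_ones_iff_successively:
  "no_consecutive_ones x \<longleftrightarrow> successively (\<lambda>a b. \<not> (a \<and> b)) x"
  by (simp add: no_consecutive_ones_def successively_conv_nth)

lemma no_consecutive_ones_rev [simp]: "no_consecutive_ones (rev x) \<longleftrightarrow> no_consecutive_ones x"
  by (auto simp: no_consecutive_ones_iff_successively elim: successively_mono)

lemma rev_fib_strings [simp]: "rev x \<in> fib_strings n \<longleftrightarrow> x \<in> fib_strings n"
  by (simp add: fib_strings_def)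

lemma finite_fib_strings [simp]: "finite (fib_strings n)"
proof (rule finite_subset)
  show "fib_strings n \<subseteq> {x. set x \<subseteq> UNIV \<and> length x = n}"
    by (auto simp: fib_strings_def)
qed (rule finite_lists_length_eq, simp)

lemma flip_one_fib_strings: "x \<in> fib_strings n \<Longrightarrow> i < n \<Longrightarrow> x ! i \<Longrightarrow> flip x i \<in> fib_strings n"
  by (auto simp: fib_strings_def no_consecutive_ones_def nth_flip)

lemma zeros_fib_strings [simp]: "zeros n \<in> fib_strings n"
  by (auto simp: fib_strings_def no_consecutive_ones_def)

lemma nth_flip_zeros: "i < n \<Longrightarrow> k < n \<Longrightarrow> flip (zeros n) i ! k \<longleftrightarrow> k = i"
  by (simp add: nth_flip)

lemma flip_zeros_fib_strings: "i < n \<Longrightarrow> flip (zeros n) i \<in> fib_strings n"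
  by (auto simp: fib_strings_def no_consecutive_ones_def nth_flip_zeros)

lemma eq_zeros_iff: "x = zeros n \<longleftrightarrow> length x = n \<and> (\<forall>i<n. \<not> x ! i)"
  by (auto simp: list_eq_iff_nth_eq)

lemma verts_fibonacci_cube: "verts (fibonacci_cube n) = fib_strings n"
  by (auto simp: fibonacci_cube_def induced_subgraph_def hypercube_def fib_strings_def)

section \<open>Edges as single flips, oriented from the upper endpoint\<close>

lemma differ_once_iff_flip:
  assumes "length x = n" "length y = n"
  shows "card {i. i < n \<and> x ! i \<noteq> y ! i} = 1 \<longleftrightarrow> (\<exists>i<n. y = flip x i)"
proof
  assume "card {i. i < n \<and> x ! i \<noteq> y ! i} = 1"
  then obtain i where i: "{i. i < n \<and> x ! i \<noteq> y ! i} = {i}"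
    by (auto simp: card_1_singleton_iff)
  then have "i < n" "x ! i \<noteq> y ! i" by blast+
  moreover have "x ! k = y ! k" if "k < n" "k \<noteq> i" for k
    using i that by blast
  ultimately have "y = flip x i"
    using assms by (auto simp: list_eq_iff_nth_eq nth_flip)
  with \<open>i < n\<close> show "\<exists>i<n. y = flip x i" by blast
next
  assume "\<exists>i<n. y = flip x i"
  then obtain i where "i < n" "y = flip x i" by blast
  then have "{i. i < n \<and> x ! i \<noteq> y ! i} = {i}"
    using assms by (auto simp: nth_flip)
  then show "card {i. i < n \<and> x ! i \<noteq> y ! i} = 1" by simp
qed

lemma edge_iff:
  "{x, y} \<in> edges (fibonacci_cube n) \<longleftrightarrow>
     x \<in> fib_strings n \<and> y \<in> fib_strings n \<and> (\<exists>i<n. y = flip x i)"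
proof -
  let ?D = "\<lambda>u v. card {i. i < n \<and> u ! i \<noteq> v ! i} = 1"
  \<comment> \<open>An edge is an unordered pair, so \<open>{x, y}\<close> may match
    \<open>{u, v}\<close> crosswise.\<close>
  have sym: "?D u v \<longleftrightarrow> ?D v u" for u v :: "bool list"
    by (rule arg_cong[where f = "\<lambda>A. card A = 1"]) auto
  have "{x, y} \<in> edges (fibonacci_cube n) \<longleftrightarrow> x \<in> fib_strings n \<and> y \<in> fib_strings n \<and>
     (\<exists>u v. {x, y} = {u, v} \<and> length u = n \<and> length v = n \<and> ?D u v)"
    unfolding fibonacci_cube_def induced_subgraph_def hypercube_def fib_strings_def
    by (simp add: doubleton_eq_iff) blast
  also have "\<dots> \<longleftrightarrow> x \<in> fib_strings n \<and> y \<in> fib_strings n \<and> ?D x y"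
    using sym by (simp only: fib_strings_def mem_Collect_eq doubleton_eq_iff) blast
  also have "\<dots> \<longleftrightarrow> x \<in> fib_strings n \<and> y \<in> fib_strings n \<and> (\<exists>i<n. y = flip x i)"
    using differ_once_iff_flip[of x n y] by (simp only: fib_strings_def mem_Collect_eq) blast
  finally show ?thesis .
qed

text \<open>Orients an edge downwards: \<open>x\<close> is the endpoint with a 1 at the flipped
  position. By \<open>edge_eqD\<close> this description of an edge is unique.\<close>

lemma edgeE:
  assumes "e \<in> edges (fibonacci_cube n)"
  obtains x i where "x \<in> fib_strings n" "i < n" "x ! i" "e = {x, flip x i}"
proof -
  from assms simple_graph_fibonacci_cube[of n] obtain u v where uv: "e = {u, v}"
    unfolding simple_graph_def by blast
  with assms obtain i where i: "u \<in> fib_strings n" "v \<in> fib_strings n" "i < n" "v = flip u i"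
    by (auto simp: edge_iff)
  show ?thesis
  proof (cases "u ! i")
    case True
    with i uv that show ?thesis by blast
  next
    case False
    with i have "v ! i" by (simp add: nth_flip fib_strings_def)
    with i uv that[of v i] show ?thesis by (simp add: insert_commute)
  qed
qed

lemma edges_fibonacci_cube:
  "edges (fibonacci_cube n) =
     (\<lambda>(x, i). {x, flip x i}) ` (SIGMA x:fib_strings n. {i. i < n \<and> x ! i})"
  (is "_ = ?f ` ?S")
proof
  show "edges (fibonacci_cube n) \<subseteq> ?f ` ?S"
  proof
    fix e assume "e \<in> edges (fibonacci_cube n)"
    then obtain x i where "x \<in> fib_strings n" "i < n" "x ! i" "e = {x, flip x i}"
      by (rule edgeE)
    then show "e \<in> ?f ` ?S" by (intro image_eqI[of _ _ "(x, i)"]) auto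
  qed
  show "?f ` ?S \<subseteq> edges (fibonacci_cube n)"
    by (auto simp: edge_iff flip_one_fib_strings)
qed

lemma edge_eqD:
  assumes "{x, flip x i} = {y, flip y j}"
    and "i < length x" "j < length y" "x ! i" "y ! j"
  shows "x = y \<and> i = j"
proof -
  from assms(1) consider "x = y" "flip x i = flip y j" | "x = flip y j" "flip x i = y"
    by (auto simp: doubleton_eq_iff)
  then show ?thesis
  proof cases
    case 1
    with assms inj_on_flip[of x] show ?thesis by (auto simp: inj_on_def)
  next
    \<comment> \<open>Crossed endpoints are impossible: each string would have fewer 1s than the
      other.\<close>
    case 2
    then have "i = j" using assms by (metis length_flip nth_flip)
    with 2 assms show ?thesis by (simp add: nth_flip)
  qed
qed

text \<open>Each edge is counted at its upper endpoint, where the downward edges correspond to the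
  1s.\<close>

lemma card_edges_eq_sum_count:
  "card (edges (fibonacci_cube n)) = (\<Sum>x\<in>fib_strings n. count_list x True)"
proof -
  let ?S = "SIGMA x:fib_strings n. {i. i < n \<and> x ! i}"
  have "inj_on (\<lambda>(x, i). {x, flip x i}) ?S"
  proof (rule inj_onI, clarify)
    fix x i y j
    assume "x \<in> fib_strings n" "y \<in> fib_strings n" "i < n" "j < n" "x ! i" "y ! j"
      and "{x, flip x i} = {y, flip y j}"
    then show "x = y \<and> i = j"
      by (intro edge_eqD) (simp_all add: fib_strings_def)
  qed
  then have "card (edges (fibonacci_cube n)) = card ?S"
    unfolding edges_fibonacci_cube by (rule card_image)
  also have "\<dots> = (\<Sum>x\<in>fib_strings n. card {i. i < n \<and> x ! i})"
    by (subst card_SigmaI) auto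
  also have "\<dots> = (\<Sum>x\<in>fib_strings n. count_list x True)"
    by (intro sum.cong refl)
      (simp add: fib_strings_def count_list_eq_length_filter length_filter_conv_card)
  finally show ?thesis .
qed

section \<open>Automorphisms\<close>

definition cube_neighbours :: "nat \<Rightarrow> bool list \<Rightarrow> bool list set" where
  "cube_neighbours n x = {y. {x, y} \<in> edges (fibonacci_cube n)}"

lemma cube_neighbours_eq:
  "x \<in> fib_strings n \<Longrightarrow> cube_neighbours n x = flip x ` {i. i < n \<and> flip x i \<in> fib_strings n}"
  by (auto simp: cube_neighbours_def edge_iff)

lemma card_cube_neighbours:
  assumes "x \<in> fib_strings n"
  shows "card (cube_neighbours n x) = card {i. i < n \<and> flip x i \<in> fib_strings n}"
proof -
  have "inj_on (flip x) {i. i < n \<and> flip x i \<in> fib_strings n}"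
    using assms by (auto simp: fib_strings_def intro: inj_on_subset[OF inj_on_flip])
  then show ?thesis
    by (simp add: cube_neighbours_eq[OF assms] card_image)
qed

lemma card_cube_neighbours_zeros: "card (cube_neighbours n (zeros n)) = n"
proof -
  have "{i. i < n \<and> flip (zeros n) i \<in> fib_strings n} = {..<n}"
    by (auto intro: flip_zeros_fib_strings)
  then show ?thesis by (simp add: card_cube_neighbours)
qed

text \<open>Since \<open>n \<ge> 2\<close>, some position is adjacent to a 1; it holds a 0 and
  cannot be flipped.\<close>

lemma card_cube_neighbours_less:
  assumes "x \<in> fib_strings n" "x \<noteq> zeros n" "n \<ge> 2"
  shows "card (cube_neighbours n x) < n"
proof -
  have len: "length x = n" using assms by (simp add: fib_strings_def)
  with assms(2) obtain i where i: "i < n" "x ! i" by (auto simp: eq_zeros_iff)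
  obtain j where j: "j < n" "Suc j = i \<or> Suc i = j"
  proof (cases i)
    case 0
    then show ?thesis using that[of 1] assms(3) by simp
  next
    case (Suc k)
    then show ?thesis using that[of k] i by simp
  qed
  have "\<not> x ! j"
    using assms(1) i j by (auto simp: fib_strings_def no_consecutive_ones_def)
  then have "flip x j ! i" "flip x j ! j"
    using i j by (auto simp: nth_flip len)
  then have "flip x j \<notin> fib_strings n"
    using i j by (auto simp: fib_strings_def no_consecutive_ones_def)
  then have "{i. i < n \<and> flip x i \<in> fib_strings n} \<subset> {..<n}"
    using j(1) by auto
  then have "card {i. i < n \<and> flip x i \<in> fib_strings n} < card {..<n}"
    by (intro psubset_card_mono) auto
  then show ?thesis by (simp add: card_cube_neighbours assms(1))
qed

lemma graph_autoD:
  assumes "g \<in> graph_auto (fibonacci_cube n)"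
  shows "inj_on g (fib_strings n)" "g ` fib_strings n = fib_strings n"
    and "\<And>x. x \<in> fib_strings n \<Longrightarrow> g x \<in> fib_strings n"
    and "\<And>x y. x \<in> fib_strings n \<Longrightarrow> y \<in> fib_strings n \<Longrightarrow>
      {g x, g y} \<in> edges (fibonacci_cube n) \<longleftrightarrow> {x, y} \<in> edges (fibonacci_cube n)"
  using assms by (auto simp: graph_auto_def Bij_def bij_betw_def verts_fibonacci_cube)

lemma graph_auto_zeros:
  assumes g: "g \<in> graph_auto (fibonacci_cube n)" and n: "n \<ge> 2"
  shows "g (zeros n) = zeros n"
proof -
  note gD = graph_autoD[OF g]
  have sub: "cube_neighbours n x \<subseteq> fib_strings n" for x
    by (auto simp: cube_neighbours_def edge_iff)
  \<comment> \<open>By injectivity the image of the zero string has at least \<open>n\<close>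
    neighbours, and only the zero string has that many.\<close>
  have "g ` cube_neighbours n (zeros n) \<subseteq> cube_neighbours n (g (zeros n))"
    using sub[of "zeros n"] gD(4)[of "zeros n"] by (auto simp: cube_neighbours_def)
  moreover have "finite (cube_neighbours n (g (zeros n)))"
    using sub finite_fib_strings by (rule finite_subset)
  moreover have "card (g ` cube_neighbours n (zeros n)) = n"
    by (simp add: card_image inj_on_subset[OF gD(1) sub] card_cube_neighbours_zeros)
  ultimately have "n \<le> card (cube_neighbours n (g (zeros n)))"
    by (metis card_mono)
  then show ?thesis
    using card_cube_neighbours_less[OF gD(3)[OF zeros_fib_strings] _ n] by linarith
qed

text \<open>A string with at least two 1s is one of the only two common neighbours, in the hypercube, of
  the strings obtained by deleting one of these 1s; the other one has fewer 1s.\<close>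

lemma fixes_fib_strings:
  assumes closed: "\<And>x. x \<in> fib_strings n \<Longrightarrow> h x \<in> fib_strings n"
    and inj: "inj_on h (fib_strings n)"
    and edge: "\<And>x y. {x, y} \<in> edges (fibonacci_cube n) \<Longrightarrow> {h x, h y} \<in> edges (fibonacci_cube n)"
    and zeros: "h (zeros n) = zeros n"
    and unit: "\<And>i. i < n \<Longrightarrow> h (flip (zeros n) i) = flip (zeros n) i"
  shows "x \<in> fib_strings n \<Longrightarrow> h x = x"
proof (induction "card {k. k < n \<and> x ! k}" arbitrary: x rule: less_induct)
  case less
  have len: "length x = n" using less.prems by (simp add: fib_strings_def)
  have drop: "flip y i \<in> fib_strings n \<and> card {k. k < n \<and> flip y i ! k} < card {k. k < n \<and> y ! k}"
    if "y \<in> fib_strings n" "i < n" "y ! i" for y i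
  proof
    show "flip y i \<in> fib_strings n" using that by (rule flip_one_fib_strings)
    have "length y = n" using that by (simp add: fib_strings_def)
    then have "{k. k < n \<and> flip y i ! k} \<subset> {k. k < n \<and> y ! k}"
      using that by (auto simp: nth_flip)
    then show "card {k. k < n \<and> flip y i ! k} < card {k. k < n \<and> y ! k}"
      by (intro psubset_card_mono) auto
  qed
  show ?case
  proof (cases "x = zeros n")
    case True
    then show ?thesis by (simp add: zeros)
  next
    case False
    then obtain i where i: "i < n" "x ! i" using len by (auto simp: eq_zeros_iff)
    show ?thesis
    proof (cases "\<exists>j<n. j \<noteq> i \<and> x ! j")
      case False
      then have "x = flip (zeros n) i"
        using i len by (auto simp: list_eq_iff_nth_eq nth_flip)
      then show ?thesis using unit i by simp
    next
      case True
      then obtain j where j: "j < n" "j \<noteq> i" "x ! j" by blast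
      \<comment> \<open>Deleting one or both of the 1s leaves fewer 1s, so the induction hypothesis
        fixes the resulting strings.\<close>
      have hi: "h (flip x i) = flip x i" and hj: "h (flip x j) = flip x j"
        using less.hyps drop[OF less.prems] i j by auto
      have "flip x j ! i" using i j len by (simp add: nth_flip)
      then have hji: "h (flip (flip x j) i) = flip (flip x j) i" "flip (flip x j) i \<in> fib_strings n"
        using less.hyps[of "flip (flip x j) i"] drop[OF less.prems j(1,3)] drop[of "flip x j" i] i
        by auto
      have "{flip x k, x} \<in> edges (fibonacci_cube n)" if "k < n" "x ! k" for k
        using that drop less.prems by (auto simp: edge_iff intro!: exI[of _ k])
      \<comment> \<open>So \<open>h x\<close> is a common neighbour of two fixed strings, differing
        from them at the positions \<open>a\<close> and \<open>b\<close>.\<close>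
      from edge[OF this[OF i]] edge[OF this[OF j(1,3)]]
      have "{flip x i, h x} \<in> edges (fibonacci_cube n)" "{flip x j, h x} \<in> edges (fibonacci_cube n)"
        by (simp_all add: hi hj)
      then obtain a b where ab: "a < n" "b < n" "h x = flip (flip x i) a" "h x = flip (flip x j) b"
        by (auto simp: edge_iff)
      show ?thesis
      proof (cases "a = i")
        case True
        then show ?thesis using ab by simp
      next
        case False
        \<comment> \<open>Here \<open>h x\<close> keeps the 0 at \<open>i\<close>, where
          \<open>flip x j\<close> has a 1, so \<open>b = i\<close>. Then \<open>x\<close> and the
          fixed string with both 1s deleted would have the same image, against injectivity.\<close>
        then have "\<not> h x ! i" using ab i len by (simp add: nth_flip)
        then have "b = i" using ab(2,4) i j len by (auto simp: nth_flip split: if_splits)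
        then have "h x = h (flip (flip x j) i)" using ab hji by simp
        then have "x = flip (flip x j) i"
          using inj less.prems hji(2) by (auto dest: inj_onD)
        then have "x ! i = flip (flip x j) i ! i" by simp
        then show ?thesis using i j len by (simp add: nth_flip)
      qed
    qed
  qed
qed

section \<open>Strings with a single 1 and automorphisms of a path\<close>

text \<open>In the hypercube the only common neighbour besides the zero string is the string with 1s
  at exactly \<open>i\<close> and \<open>j\<close>; it is a vertex iff these positions are not
  adjacent.\<close>

lemma common_neighbour_units_iff:
  assumes "i < n" "j < n" "i \<noteq> j"
  shows "(\<exists>z. z \<noteq> zeros n \<and> {flip (zeros n) i, z} \<in> edges (fibonacci_cube n) \<and>
        {flip (zeros n) j, z} \<in> edges (fibonacci_cube n)) \<longleftrightarrow> Suc i \<noteq> j \<and> Suc j \<noteq> i"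
    (is "?L \<longleftrightarrow> ?R")
proof
  assume ?L
  then obtain z a b where z: "z \<noteq> zeros n" "z \<in> fib_strings n"
      "a < n" "z = flip (flip (zeros n) i) a" "b < n" "z = flip (flip (zeros n) j) b"
    unfolding edge_iff by blast
  \<comment> \<open>Flipping the same position twice would give back the zero string.\<close>
  then have "a \<noteq> i" "b \<noteq> j" by auto
  then have "z ! i" using z(3,4) assms by (simp add: nth_flip)
  moreover have "z ! j" using z(5,6) assms \<open>b \<noteq> j\<close> by (simp add: nth_flip)
  ultimately show ?R
    using z(2) assms by (auto simp: fib_strings_def no_consecutive_ones_def)
next
  assume R: ?R
  define z where "z = flip (flip (zeros n) i) j"
  have nth: "z ! k \<longleftrightarrow> k = i \<or> k = j" if "k < n" for k
    using assms that by (auto simp: z_def nth_flip)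
  then have "z \<in> fib_strings n"
    using R by (auto simp: fib_strings_def no_consecutive_ones_def z_def)
  moreover have "z \<noteq> zeros n" using nth[of i] assms by auto
  moreover have "z = flip (flip (zeros n) j) i" unfolding z_def by (rule flip_commute)
  ultimately show ?L
    using assms flip_zeros_fib_strings z_def unfolding edge_iff by blast
qed

text \<open>An injective walk with steps of size one never turns back, so it is monotone, and the
  bound \<open>n\<close> determines its start.\<close>

lemma path_injection_cases:
  fixes p :: "nat \<Rightarrow> nat"
  assumes inj: "inj_on p {..<n}" and lt: "\<And>i. i < n \<Longrightarrow> p i < n"
    and step: "\<And>i. Suc i < n \<Longrightarrow> p (Suc i) = Suc (p i) \<or> p i = Suc (p (Suc i))"
  shows "(\<forall>i<n. p i = i) \<or> (\<forall>i<n. p i = n - Suc i)"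
proof (cases "n \<ge> 2")
  case False
  \<comment> \<open>At most the position 0 exists, and both alternatives agree there.\<close>
  then show ?thesis using lt by (cases n) (auto simp: less_Suc_eq)
next
  case True
  have turn: "(p (Suc i) = Suc (p i)) = (p 1 = Suc (p 0))" if "Suc i < n" for i
    using that
  proof (induction i)
    case (Suc i)
    \<comment> \<open>Two consecutive unit steps whose ends differ go in the same direction.\<close>
    have no_return: "(c = Suc b) = (b = Suc a)"
      if "b = Suc a \<or> a = Suc b" "c = Suc b \<or> b = Suc c" "c \<noteq> a" for a b c :: nat
      using that by arith
    have "p (Suc (Suc i)) \<noteq> p i" using inj Suc.prems by (auto dest: inj_onD)
    then have "(p (Suc (Suc i)) = Suc (p (Suc i))) = (p (Suc i) = Suc (p i))"
      using step[of i] step[of "Suc i"] Suc.prems by (intro no_return) simp_all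
    then show ?case using Suc.IH Suc.prems by simp
  qed simp
  show ?thesis
  proof (cases "p 1 = Suc (p 0)")
    case True
    have *: "p i = p 0 + i" if "i < n" for i
      using that
    proof (induction i)
      case (Suc i)
      then have "p (Suc i) = Suc (p i)" using turn[of i] True by blast
      then show ?case using Suc by simp
    qed simp
    \<comment> \<open>The last value \<open>p 0 + (n - 1)\<close> must stay below
      \<open>n\<close>.\<close>
    from this[of "n - 1"] lt[of "n - 1"] have "p 0 = 0"
      using \<open>n \<ge> 2\<close> by linarith
    with * show ?thesis by simp
  next
    case False
    \<comment> \<open>The descending case is stated as a sum to avoid truncated subtraction.\<close>
    have *: "p 0 = p i + i" if "i < n" for i
      using that
    proof (induction i)
      case (Suc i)
      then have "p i = Suc (p (Suc i))" using turn[of i] False step[of i] by blast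
      then show ?case using Suc by simp
    qed simp
    from this[of "n - 1"] lt[of 0] have p0: "p 0 = n - 1"
      using \<open>n \<ge> 2\<close> by linarith
    have "p i = n - Suc i" if "i < n" for i
      using *[OF that] p0 that by linarith
    then show ?thesis by blast
  qed
qed

lemma rev_edge:
  assumes "{x, y} \<in> edges (fibonacci_cube n)"
  shows "{rev x, rev y} \<in> edges (fibonacci_cube n)"
proof -
  from assms obtain i where "x \<in> fib_strings n" "y \<in> fib_strings n" "i < n" "y = flip x i"
    by (auto simp: edge_iff)
  then have "rev x \<in> fib_strings n" "rev y \<in> fib_strings n" "n - Suc i < n"
    and "rev y = flip (rev x) (n - Suc i)"
    by (simp, simp, simp, simp add: rev_flip fib_strings_def)
  then show ?thesis unfolding edge_iff by blast
qed

lemma rev_edge_iff [simp]: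
  "{rev x, rev y} \<in> edges (fibonacci_cube n) \<longleftrightarrow> {x, y} \<in> edges (fibonacci_cube n)"
  using rev_edge rev_edge[of "rev x" "rev y"] by auto

text \<open>The strings with a single 1 are the neighbours of the fixed zero string, so
  \<open>g\<close> induces an injection \<open>p\<close> of positions. Having a second common
  neighbour is invariant under \<open>g\<close>, so \<open>p\<close> preserves adjacency of
  positions.\<close>

lemma graph_auto_unit:
  assumes g: "g \<in> graph_auto (fibonacci_cube n)" and n: "n \<ge> 2"
  shows "(\<forall>i<n. g (flip (zeros n) i) = flip (zeros n) i) \<or>
    (\<forall>i<n. g (flip (zeros n) i) = flip (zeros n) (n - Suc i))"
proof -
  let ?u = "flip (zeros n)"
  note gD = graph_autoD[OF g] and g0 = graph_auto_zeros[OF g n]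
  have "\<exists>j<n. g (?u i) = ?u j" if "i < n" for i
  proof -
    have "{zeros n, ?u i} \<in> edges (fibonacci_cube n)"
      using that flip_zeros_fib_strings by (auto simp: edge_iff)
    then have "{zeros n, g (?u i)} \<in> edges (fibonacci_cube n)"
      using gD(4)[of "zeros n" "?u i"] that by (simp add: g0 flip_zeros_fib_strings)
    then show ?thesis by (auto simp: edge_iff)
  qed
  then obtain p where p: "p i < n" "g (?u i) = ?u (p i)" if "i < n" for i
    by metis
  have inj: "inj_on p {..<n}"
  proof (rule inj_onI)
    fix i j assume ij: "i \<in> {..<n}" "j \<in> {..<n}" "p i = p j"
    then have "g (?u i) = g (?u j)" using p by simp
    then have "?u i = ?u j"
      using ij gD(1) flip_zeros_fib_strings by (auto dest: inj_onD)
    then show "i = j" using ij inj_on_flip[of "zeros n"] by (auto dest: inj_onD)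
  qed
  have "p (Suc i) = Suc (p i) \<or> p i = Suc (p (Suc i))" if i: "Suc i < n" for i
  proof (rule ccontr)
    assume neg: "\<not> ?thesis"
    have i': "i < n" using i by simp
    have "p i \<noteq> p (Suc i)" using inj i by (auto dest: inj_onD)
    \<comment> \<open>If the images were not adjacent, a second common neighbour \<open>z\<close> of
      theirs would pull back to one of \<open>?u i\<close> and \<open>?u (Suc i)\<close>, whose
      positions are adjacent.\<close>
    then obtain z where z: "z \<noteq> zeros n" "{?u (p i), z} \<in> edges (fibonacci_cube n)"
        "{?u (p (Suc i)), z} \<in> edges (fibonacci_cube n)"
      using common_neighbour_units_iff[of "p i" n "p (Suc i)"] p(1)[OF i] p(1)[OF i'] neg by auto
    then have "z \<in> fib_strings n" by (simp add: edge_iff)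
    then obtain w where w: "w \<in> fib_strings n" "z = g w" using gD(2) by blast
    have "w \<noteq> zeros n" using z(1) w g0 by auto
    moreover have "{?u i, w} \<in> edges (fibonacci_cube n)" "{?u (Suc i), w} \<in> edges (fibonacci_cube n)"
      using z(2,3) w p(2)[OF i] p(2)[OF i'] gD(4) i i' flip_zeros_fib_strings by metis+
    ultimately show False
      using common_neighbour_units_iff[of i n "Suc i"] i i' by auto
  qed
  from path_injection_cases[OF inj p(1) this] show ?thesis using p(2) by auto
qed

section \<open>Automorphisms on all strings and the orbit of an edge\<close>

lemma graph_auto_cases:
  assumes g: "g \<in> graph_auto (fibonacci_cube n)" and n: "n \<ge> 2"
  shows "(\<forall>x\<in>fib_strings n. g x = x) \<or> (\<forall>x\<in>fib_strings n. g x = rev x)"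
proof -
  note gD = graph_autoD[OF g] and g0 = graph_auto_zeros[OF g n]
  have edge: "{g x, g y} \<in> edges (fibonacci_cube n)" if "{x, y} \<in> edges (fibonacci_cube n)" for x y
    using that gD(4)[of x y] by (simp add: edge_iff)
  from graph_auto_unit[OF g n] show ?thesis
  proof
    assume "\<forall>i<n. g (flip (zeros n) i) = flip (zeros n) i"
    then show ?thesis using fixes_fib_strings[of n g] gD(1,3) edge g0 by blast
  next
    assume *: "\<forall>i<n. g (flip (zeros n) i) = flip (zeros n) (n - Suc i)"
    \<comment> \<open>Composing with the reversal reduces this case to the identity on strings with
      a single 1.\<close>
    have "(rev \<circ> g) x = x" if "x \<in> fib_strings n" for x
    proof (rule fixes_fib_strings[OF _ _ _ _ _ that])
      show "inj_on (rev \<circ> g) (fib_strings n)"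
        using gD(1) by (auto simp: inj_on_def)
      show "(rev \<circ> g) (flip (zeros n) i) = flip (zeros n) i" if "i < n" for i
        using that * by (simp add: rev_flip Suc_diff_Suc)
    qed (use gD(3) edge g0 in auto)
    then show ?thesis by (metis comp_apply rev_rev_ident)
  qed
qed

lemma graph_auto_image_edge:
  assumes g: "g \<in> graph_auto (fibonacci_cube n)" and e: "e \<in> edges (fibonacci_cube n)"
  shows "g ` e = e \<or> g ` e = rev ` e"
proof -
  obtain x i where x: "x \<in> fib_strings n" "i < n" "x ! i" "e = {x, flip x i}"
    using e by (rule edgeE)
  then have fx: "flip x i \<in> fib_strings n" by (simp add: flip_one_fib_strings)
  show ?thesis
  proof (cases "n \<ge> 2")
    case True
    then show ?thesis using graph_auto_cases[OF g] x fx by auto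
  next
    case False
    \<comment> \<open>For \<open>n = 1\<close> the swap of the two vertices is an automorphism that
      is neither the identity nor the reversal, but it preserves the only edge.\<close>
    then have "n = 1" using x by simp
    then have sub: "fib_strings n \<subseteq> {[True], [False]}"
      by (auto simp: fib_strings_def length_Suc_conv)
    have pair: "{u, v} = {[True], [False]}" if "u \<in> fib_strings n" "v \<in> fib_strings n" "u \<noteq> v" for u v
      using that subsetD[OF sub that(1)] subsetD[OF sub that(2)] by auto
    have "flip x i ! i \<noteq> x ! i"
      using x by (simp add: nth_flip fib_strings_def)
    then have neq: "x \<noteq> flip x i" by metis
    then have "g x \<noteq> g (flip x i)"
      using x fx graph_autoD(1)[OF g] by (meson inj_onD)
    then have "{g x, g (flip x i)} = {x, flip x i}"
      using pair x(1) fx neq graph_autoD(3)[OF g] by metis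
    then show ?thesis by (simp add: x(4))
  qed
qed

lemma id_graph_auto: "restrict id (verts (fibonacci_cube n)) \<in> graph_auto (fibonacci_cube n)"
  by (auto simp: graph_auto_def Bij_def intro: bij_betwI')

lemma rev_graph_auto: "restrict rev (verts (fibonacci_cube n)) \<in> graph_auto (fibonacci_cube n)"
proof -
  have "bij_betw (restrict rev (fib_strings n)) (fib_strings n) (fib_strings n)"
    by (intro bij_betwI[where g = rev]) auto
  then show ?thesis
    by (simp add: graph_auto_def Bij_def verts_fibonacci_cube)
qed

lemma orbit_edge:
  assumes e: "e \<in> edges (fibonacci_cube n)"
  shows "orbit (Aut (fibonacci_cube n)) (edge_action (fibonacci_cube n)) e = {e, rev ` e}"
proof -
  have sub: "e \<subseteq> verts (fibonacci_cube n)"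
    using e by (auto simp: verts_fibonacci_cube flip_one_fib_strings elim: edgeE)
  \<comment> \<open>Automorphisms are extensional, so the identity and the reversal enter as
    restrictions, which agree with them on \<open>e\<close>.\<close>
  have res: "restrict f (verts (fibonacci_cube n)) ` e = f ` e" for f :: "bool list \<Rightarrow> bool list"
    using sub by (intro image_cong) auto
  have mem: "e \<in> (\<lambda>g. g ` e) ` graph_auto (fibonacci_cube n)"
    "rev ` e \<in> (\<lambda>g. g ` e) ` graph_auto (fibonacci_cube n)"
    by (rule image_eqI[OF _ id_graph_auto], simp only: res image_id id_apply)
      (rule image_eqI[OF _ rev_graph_auto], simp only: res)
  have "(\<lambda>g. g ` e) ` graph_auto (fibonacci_cube n) \<subseteq> {e, rev ` e}"
    using graph_auto_image_edge[OF _ e] by (intro image_subsetI) blast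
  with mem have "(\<lambda>g. g ` e) ` graph_auto (fibonacci_cube n) = {e, rev ` e}"
    by (metis empty_subsetI equalityI insert_subset)
  moreover have "orbit (Aut (fibonacci_cube n)) (edge_action (fibonacci_cube n)) e =
      (\<lambda>g. g ` e) ` graph_auto (fibonacci_cube n)"
    by (simp add: orbit_def Aut_def edge_action_def e image_def Bex_def conj_commute)
  ultimately show ?thesis by simp
qed

section \<open>Counting edges and orbits\<close>

lemma no_consecutive_ones_Nil [simp]: "no_consecutive_ones []"
  by (simp add: no_consecutive_ones_def)

lemma no_consecutive_ones_single [simp]: "no_consecutive_ones [a]"
  by (simp add: no_consecutive_ones_def)

lemma no_consecutive_ones_append:
  "no_consecutive_ones (x @ y) \<longleftrightarrow> no_consecutive_ones x \<and> no_consecutive_ones y \<and>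
     (x = [] \<or> y = [] \<or> \<not> (last x \<and> hd y))"
  unfolding no_consecutive_ones_iff_successively by (rule successively_append_iff)

lemma no_consecutive_ones_Cons:
  "no_consecutive_ones (a # x) \<longleftrightarrow> no_consecutive_ones x \<and> (x = [] \<or> \<not> (a \<and> hd x))"
  using no_consecutive_ones_append[of "[a]" x] by auto

lemma fib_strings_0: "fib_strings 0 = {[]}"
  by (auto simp: fib_strings_def)

lemma fib_strings_1: "fib_strings (Suc 0) = {[False], [True]}"
  by (auto simp: fib_strings_def length_Suc_conv no_consecutive_ones_Cons)

text \<open>A leading 1 forces the second digit to be 0, which gives the Fibonacci
  recurrence.\<close>

lemma fib_strings_Suc_Suc:
  "fib_strings (Suc (Suc n)) =
     Cons False ` fib_strings (Suc n) \<union> (\<lambda>x. True # False # x) ` fib_strings n"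
  by (auto simp: fib_strings_def length_Suc_conv no_consecutive_ones_Cons image_iff)

lemma sum_fib_strings_Suc_Suc:
  "(\<Sum>x\<in>fib_strings (Suc (Suc n)). f x) =
     (\<Sum>x\<in>fib_strings (Suc n). f (False # x)) + (\<Sum>x\<in>fib_strings n. f (True # False # x))"
  unfolding fib_strings_Suc_Suc
  by (subst sum.union_disjoint) (auto simp: sum.reindex inj_on_def)

lemma card_fib_strings: "card (fib_strings n) = fib (n + 2)"
proof (induction n rule: fib.induct)
  case (3 n)
  have "card (fib_strings (Suc (Suc n))) = card (fib_strings (Suc n)) + card (fib_strings n)"
    using sum_fib_strings_Suc_Suc[of "\<lambda>_. 1 :: nat" n] by simp
  with 3 show ?case by simp
qed (simp_all add: fib_strings_0 fib_strings_1)

text \<open>The total number of 1s satisfies the Fibonacci recurrence with the extra term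
  \<open>fib (n + 2)\<close>, one leading 1 for each string of the second kind. The closed form
  obeys the same recurrence; the factor 5 keeps it in the naturals.\<close>

lemma card_edges_fibonacci_cube:
  "5 * card (edges (fibonacci_cube n)) = n * fib (n + 1) + 2 * (n + 1) * fib n"
proof -
  let ?W = "\<lambda>n. \<Sum>x\<in>fib_strings n. count_list x True"
  have "5 * ?W n = n * fib (n + 1) + 2 * (n + 1) * fib n"
  proof (induction n rule: fib.induct)
    case (3 n)
    have "?W (Suc (Suc n)) = ?W (Suc n) + ?W n + fib (n + 2)"
      by (subst sum_fib_strings_Suc_Suc) (simp add: sum.distrib sum_Suc card_fib_strings)
    with 3 show ?case by (simp add: algebra_simps)
  qed (simp_all add: fib_strings_0 fib_strings_1)
  then show ?thesis by (simp add: card_edges_eq_sum_count)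
qed

section \<open>Edges fixed by reversal\<close>

text \<open>The reversed edge has upper endpoint \<open>rev x\<close> and flipped position
  \<open>n - Suc i\<close>; uniqueness of the oriented form equates these with \<open>x\<close> and
  \<open>i\<close>.\<close>

lemma edge_rev_fixed_iff:
  assumes "x \<in> fib_strings n" "i < n" "x ! i"
  shows "rev ` {x, flip x i} = {x, flip x i} \<longleftrightarrow> rev x = x \<and> n = 2 * i + 1"
proof -
  have len: "length x = n" using assms by (simp add: fib_strings_def)
  have img: "rev ` {x, flip x i} = {rev x, flip (rev x) (n - Suc i)}"
    using assms len by (simp add: rev_flip)
  show ?thesis
  proof
    assume "rev ` {x, flip x i} = {x, flip x i}"
    then have "rev x = x \<and> n - Suc i = i"
      unfolding img using assms len by (intro edge_eqD) (simp_all add: rev_nth Suc_diff_Suc)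
    then show "rev x = x \<and> n = 2 * i + 1" using assms by auto
  next
    assume "rev x = x \<and> n = 2 * i + 1"
    then show "rev ` {x, flip x i} = {x, flip x i}" unfolding img by simp
  qed
qed

text \<open>Counts the right halves of palindromes with a middle 1. A nonempty half starts with a
  forced 0, leaving \<open>k - 1\<close> digits to choose.\<close>

lemma card_fib_strings_after_one: "card {y. length y = k \<and> no_consecutive_ones (True # y)} = fib (k + 1)"
proof (cases k)
  case 0
  then have "{y. length y = k \<and> no_consecutive_ones (True # y)} = {[]}"
    by (auto simp: no_consecutive_ones_Cons)
  with 0 show ?thesis by simp
next
  case (Suc m)
  then have "{y. length y = k \<and> no_consecutive_ones (True # y)} = Cons False ` fib_strings m"
    by (auto simp: fib_strings_def length_Suc_conv no_consecutive_ones_Cons)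
  with Suc show ?thesis by (simp add: card_image card_fib_strings)
qed

text \<open>Such a palindrome is determined by its right half, and by symmetry adjacent 1s need only
  be excluded in the middle 1 followed by that half.\<close>

lemma card_palindromic_fib_strings:
  "card {x \<in> fib_strings (2 * k + 1). rev x = x \<and> x ! k} = fib (k + 1)"
proof -
  let ?f = "\<lambda>y. rev y @ True # y" and ?Y = "{y. length y = k \<and> no_consecutive_ones (True # y)}"
  have nc: "no_consecutive_ones (?f y) \<longleftrightarrow> no_consecutive_ones (True # y)" for y
    by (auto simp: no_consecutive_ones_append no_consecutive_ones_Cons last_rev)
  have "{x \<in> fib_strings (2 * k + 1). rev x = x \<and> x ! k} = ?f ` ?Y"
  proof (intro equalityI subsetI)
    fix x assume x: "x \<in> {x \<in> fib_strings (2 * k + 1). rev x = x \<and> x ! k}"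
    then have len: "length x = 2 * k + 1" by (simp add: fib_strings_def)
    have "take k x = take k (rev x)" using x by simp
    also have "\<dots> = rev (drop (Suc k) x)" by (simp add: take_rev len)
    finally have "x = ?f (drop (Suc k) x)"
      using id_take_nth_drop[of k x] len x by simp
    moreover from this have "drop (Suc k) x \<in> ?Y"
      using x len nc[of "drop (Suc k) x"] by (simp add: fib_strings_def)
    ultimately show "x \<in> ?f ` ?Y" by (rule image_eqI)
  next
    fix x assume "x \<in> ?f ` ?Y"
    then show "x \<in> {x \<in> fib_strings (2 * k + 1). rev x = x \<and> x ! k}"
      using nc by (auto simp: fib_strings_def nth_append)
  qed
  moreover have "inj_on ?f ?Y" by (rule inj_onI) simp
  ultimately show ?thesis by (simp only: card_image card_fib_strings_after_one)
qed

text \<open>Even lengths have no middle position; for \<open>n = 2 * k + 1\<close> the fixed edges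
  correspond to their upper endpoints, the palindromes with a 1 at \<open>k\<close>.\<close>

lemma card_rev_fixed_edges:
  "card {e \<in> edges (fibonacci_cube n). rev ` e = e} = (if odd n then fib ((n + 1) div 2) else 0)"
proof (cases "odd n")
  case False
  have "rev ` e \<noteq> e" if "e \<in> edges (fibonacci_cube n)" for e
    using that
  proof (rule edgeE)
    fix x i assume "x \<in> fib_strings n" "i < n" "x ! i" "e = {x, flip x i}"
    then show ?thesis using edge_rev_fixed_iff[of x n i] False by auto
  qed
  then have "{e \<in> edges (fibonacci_cube n). rev ` e = e} = {}" by blast
  with False show ?thesis by (simp only: card.empty if_False)
next
  case True
  then obtain k where n: "n = 2 * k + 1" by (elim oddE)
  let ?P = "{x \<in> fib_strings n. rev x = x \<and> x ! k}"
  have "{e \<in> edges (fibonacci_cube n). rev ` e = e} = (\<lambda>x. {x, flip x k}) ` ?P"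
  proof (intro equalityI subsetI)
    fix e assume "e \<in> {e \<in> edges (fibonacci_cube n). rev ` e = e}"
    then have e: "e \<in> edges (fibonacci_cube n)" "rev ` e = e" by simp_all
    from e(1) obtain x i where x: "x \<in> fib_strings n" "i < n" "x ! i" "e = {x, flip x i}"
      by (rule edgeE)
    with e(2) have "rev x = x" "i = k" using edge_rev_fixed_iff[of x n i] n by auto
    with x show "e \<in> (\<lambda>x. {x, flip x k}) ` ?P" by blast
  next
    fix e assume "e \<in> (\<lambda>x. {x, flip x k}) ` ?P"
    then obtain x where x: "x \<in> fib_strings n" "rev x = x" "x ! k" "e = {x, flip x k}" by blast
    moreover have "k < n" using n by simp
    ultimately have "e \<in> edges (fibonacci_cube n)"
      unfolding x(4) edge_iff using flip_one_fib_strings by blast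
    moreover have "rev ` e = e"
      using edge_rev_fixed_iff[of x n k] x \<open>k < n\<close> n by simp
    ultimately show "e \<in> {e \<in> edges (fibonacci_cube n). rev ` e = e}" by simp
  qed
  moreover have "inj_on (\<lambda>x. {x, flip x k}) ?P"
  proof (rule inj_onI)
    fix x y assume "x \<in> ?P" "y \<in> ?P" "{x, flip x k} = {y, flip y k}"
    then show "x = y" using edge_eqD[of x k y k] n by (simp add: fib_strings_def)
  qed
  ultimately have "card {e \<in> edges (fibonacci_cube n). rev ` e = e} = card ?P"
    by (simp only: card_image)
  also have "\<dots> = fib (k + 1)" unfolding n by (rule card_palindromic_fib_strings)
  finally show ?thesis using n by simp
qed

section \<open>Orbits of an involution and the final count\<close>

text \<open>The sets \<open>{e, R e}\<close> partition \<open>E\<close> into blocks of size 1, the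
  fixed points, and of size 2.\<close>

lemma card_involution_orbits:
  fixes R :: "'a \<Rightarrow> 'a"
  assumes fin: "finite E" and closed: "\<And>e. e \<in> E \<Longrightarrow> R e \<in> E"
    and inv: "\<And>e. e \<in> E \<Longrightarrow> R (R e) = e"
  defines "X \<equiv> (\<lambda>e. {e, R e}) ` E"
  shows "card {A \<in> X. card A = 1} = card {e \<in> E. R e = e}"
    and "card X = card {A \<in> X. card A = 1} + card {A \<in> X. card A = 2}"
    and "card E = card {A \<in> X. card A = 1} + 2 * card {A \<in> X. card A = 2}"
proof -
  have finX: "finite X" using fin by (simp add: X_def)
  have "{A \<in> X. card A = 1} = (\<lambda>e. {e}) ` {e \<in> E. R e = e}"
    by (auto simp: X_def card_insert_if split: if_splits)
  then show "card {A \<in> X. card A = 1} = card {e \<in> E. R e = e}"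
    by (simp add: card_image)
  have split: "{A \<in> X. card A = 1} \<union> {A \<in> X. card A = 2} = X"
    by (auto simp: X_def card_insert_if split: if_splits)
  have fin12: "finite {A \<in> X. card A = 1}" "finite {A \<in> X. card A = 2}"
    and disj: "{A \<in> X. card A = 1} \<inter> {A \<in> X. card A = 2} = {}"
    using finX by auto
  from card_Un_disjoint[OF fin12 disj]
  show "card X = card {A \<in> X. card A = 1} + card {A \<in> X. card A = 2}"
    unfolding split .
  have "disjnt {a, R a} {b, R b}" if "a \<in> E" "b \<in> E" "{a, R a} \<noteq> {b, R b}" for a b
  proof (rule ccontr)
    assume "\<not> disjnt {a, R a} {b, R b}"
    then have "a = b \<or> a = R b \<or> b = R a \<or> R a = R b"
      by (auto simp: disjnt_def)
    then have "{a, R a} = {b, R b}"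
      using inv[OF that(1)] inv[OF that(2)] by (metis insert_commute)
    with that(3) show False ..
  qed
  then have "pairwise disjnt X"
    by (auto simp: pairwise_def X_def)
  moreover have "\<Union>X = E" using closed by (auto simp: X_def)
  ultimately have "card E = (\<Sum>A\<in>X. card A)"
    using card_Union_disjoint[of X] by (auto simp: X_def)
  also have "\<dots> = (\<Sum>A | A \<in> X \<and> card A = 1. card A) + (\<Sum>A | A \<in> X \<and> card A = 2. card A)"
    using sum.union_disjoint[OF fin12 disj, of card] unfolding split .
  finally show "card E = card {A \<in> X. card A = 1} + 2 * card {A \<in> X. card A = 2}"
    by simp
qed

lemma edge_orbits_fibonacci_cube:
  "edge_orbits (fibonacci_cube n) = (\<lambda>e. {e, rev ` e}) ` edges (fibonacci_cube n)"
proof -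
  have "edge_orbits (fibonacci_cube n) =
      orbit (Aut (fibonacci_cube n)) (edge_action (fibonacci_cube n)) ` edges (fibonacci_cube n)"
    unfolding edge_orbits_def orbits_def by blast
  also have "\<dots> = (\<lambda>e. {e, rev ` e}) ` edges (fibonacci_cube n)"
    by (intro image_cong refl orbit_edge)
  finally show ?thesis .
qed

theorem theorem4p3:
  fixes n :: nat
  shows "real (num_edge_orbits_of_size (fibonacci_cube n) 1) =
      (1 - (-1) ^ n) / 2 * real (fib ((n + 1) div 2))
    \<and> real (num_edge_orbits_of_size (fibonacci_cube n) 2) =
      1 / 10 * (real n * real (fib (n + 1)) + 2 * (real n + 1) * real (fib n))
      - (1 - (-1) ^ n) / 4 * real (fib ((n + 1) div 2))
    \<and> real (num_edge_orbits (fibonacci_cube n)) =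
      1 / 10 * (real n * real (fib (n + 1)) + 2 * (real n + 1) * real (fib n))
      + (1 - (-1) ^ n) / 4 * real (fib ((n + 1) div 2))"
proof -
  let ?E = "edges (fibonacci_cube n)"
  define f where "f = (1 - (-1) ^ n) / 2 * real (fib ((n + 1) div 2))"
  define w where "w = real n * real (fib (n + 1)) + 2 * (real n + 1) * real (fib n)"
  have fin: "finite ?E"
    unfolding edges_fibonacci_cube by (intro finite_imageI finite_SigmaI) auto
  have closed: "rev ` e \<in> ?E" if e: "e \<in> ?E" for e
  proof -
    from e obtain x i where "e = {x, flip x i}" by (rule edgeE)
    with e show ?thesis by simp
  qed
  have inv: "rev ` rev ` e = e" for e :: "bool list set"
    by (simp add: image_image)
  have num: "num_edge_orbits_of_size (fibonacci_cube n) k =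
      card {A \<in> (\<lambda>e. {e, rev ` e}) ` ?E. card A = k}"
    "num_edge_orbits (fibonacci_cube n) = card ((\<lambda>e. {e, rev ` e}) ` ?E)" for k
    by (simp_all only: num_edge_orbits_of_size_def num_edge_orbits_def edge_orbits_fibonacci_cube)
  have orbs: "num_edge_orbits_of_size (fibonacci_cube n) 1 = card {e \<in> ?E. rev ` e = e}"
    "num_edge_orbits (fibonacci_cube n) = num_edge_orbits_of_size (fibonacci_cube n) 1 +
       num_edge_orbits_of_size (fibonacci_cube n) 2"
    "card ?E = num_edge_orbits_of_size (fibonacci_cube n) 1 +
       2 * num_edge_orbits_of_size (fibonacci_cube n) 2"
    using card_involution_orbits[of ?E "(`) rev"] fin closed inv unfolding num by blast+
  \<comment> \<open>The factor \<open>(1 - (-1) ^ n) / 2\<close> is 1 for odd \<open>n\<close> and 0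
    for even \<open>n\<close>.\<close>
  have f: "real (num_edge_orbits_of_size (fibonacci_cube n) 1) = f"
    unfolding orbs(1) card_rev_fixed_edges f_def by simp
  have "5 * real (card ?E) = w"
    unfolding w_def
    using arg_cong[OF card_edges_fibonacci_cube[of n], of real] by (simp add: algebra_simps)
  moreover have "real (card ?E) = f + 2 * real (num_edge_orbits_of_size (fibonacci_cube n) 2)"
    using orbs(3) f by simp
  moreover have "real (num_edge_orbits (fibonacci_cube n)) =
      f + real (num_edge_orbits_of_size (fibonacci_cube n) 2)"
    using orbs(2) f by simp
  moreover have "(1 - (-1) ^ n) / 4 * real (fib ((n + 1) div 2)) = f / 2"
    by (simp add: f_def)
  \<comment> \<open>With \<open>s\<close> orbits of size 2, \<open>w / 5 = f + 2 * s\<close> gives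
    \<open>s = w / 10 - f / 2\<close>, and the total \<open>f + s\<close> is
    \<open>w / 10 + f / 2\<close>.\<close>
  ultimately show ?thesis
    using f unfolding f_def[symmetric] w_def[symmetric] by (intro conjI; linarith)
qed

end
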